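(* Let $p\in(0,1]$, let $W$ be a probability measure on $[0,1]$ admitting a density, and let the prior on the basin size $s\in[0,1]$ be the spike-and-slab prior $\Pi=p\,\delta_1+(1-p)W$, where $\delta_1$ is the Dirac mass at $1$. Suppose there are constants $C>0$, $\gamma>0$, $\delta>0$ such that $$W([1-u,1])\le C u^{\gamma}\qquad\text{for all }u\in(0,\delta].$$ Then $$1-\Pi(s=1\mid H_n)=O(n^{-\gamma})\qquad (n\to\infty).$$
   Context: $H_n$ is the event that $n$ runs, conditionally independent given $s$ and each reaching a fixed outcome with probability $s$, all reach that outcome; its likelihood is $\mathbb P(H_n\mid s)=s^n$. The posterior is $\Pi(A\mid H_n)=\int_A s^n\,d\Pi(s)\big/\int_{[0,1]} s^n\,d\Pi(s)$ for Borel $A\subseteq[0,1]$. *)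

theory Defs
  imports "HOL-Probability.Probability" "HOL-Library.Landau_Symbols"
begin

abbreviation unit_borel :: "real measure" where
  "unit_borel \<equiv> restrict_space borel {0..1}"

abbreviation unit_lborel :: "real measure" where
  "unit_lborel \<equiv> restrict_space lborel {0..1}"

definition spike_slab :: "real \<Rightarrow> real measure \<Rightarrow> real measure" where
  "spike_slab p W = measure_of {0..1} (sets unit_borel)
     (\<lambda>A. ennreal p * emeasure (return unit_borel 1) A + ennreal (1 - p) * emeasure W A)"

(* n runs, independent given s; the value True records that a run reaches the fixed outcome.
   The False below is only the value taken outside the index set {..<n}. *)
definition runs :: "nat \<Rightarrow> real \<Rightarrow> (nat \<Rightarrow> bool) pmf" where
  "runs n s = Pi_pmf {..<n} False (\<lambda>_. bernoulli_pmf s)"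

definition H :: "nat \<Rightarrow> (nat \<Rightarrow> bool) set" where
  "H n = {\<omega>. \<forall>i<n. \<omega> i}"

definition likelihood :: "nat \<Rightarrow> real \<Rightarrow> real" where
  "likelihood n s = measure_pmf.prob (runs n s) (H n)"

definition posterior :: "real measure \<Rightarrow> nat \<Rightarrow> real set \<Rightarrow> real" where
  "posterior P n A = (LINT s:A|P. likelihood n s) / (LINT s|P. likelihood n s)"

lemma likelihood_eq:
  assumes "s \<in> {0..1}"
  shows "likelihood n s = s ^ n"
proof -
  have "H n = Pi {..<n} (\<lambda>_. {True})"
    by (auto simp: H_def Pi_def)
  then have "likelihood n s = (\<Prod>i<n. measure_pmf.prob (bernoulli_pmf s) {True})"
    by (simp add: likelihood_def runs_def measure_Pi_pmf_Pi)
  then show ?thesis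
    using assms by (simp add: measure_pmf_single)
qed

lemma posterior_eq:
  assumes "space P = {0..1}"
  shows "posterior P n A = (LINT s:A|P. s ^ n) / (LINT s|P. s ^ n)"
proof -
  have "(LINT s:A|P. likelihood n s) = (LINT s:A|P. s ^ n)"
    unfolding set_lebesgue_integral_def
    by (rule Bochner_Integration.integral_cong) (auto simp: assms likelihood_eq)
  moreover have "(LINT s|P. likelihood n s) = (LINT s|P. s ^ n)"
    by (rule Bochner_Integration.integral_cong) (auto simp: assms likelihood_eq)
  ultimately show ?thesis
    by (simp add: posterior_def)
qed

lemma sets_spike_slab [simp, measurable_cong]: "sets (spike_slab p W) = sets unit_borel"
  using sets.sigma_sets_eq[of unit_borel] sets.space_closed[of unit_borel]
  by (simp add: spike_slab_def space_restrict_space sets_measure_of)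

lemma space_spike_slab [simp]: "space (spike_slab p W) = {0..1}"
  using sets_eq_imp_space_eq[OF sets_spike_slab] by (simp add: space_restrict_space)

lemma emeasure_spike_slab:
  assumes W: "sets W = sets unit_borel" and A: "A \<in> sets unit_borel"
  shows "emeasure (spike_slab p W) A = ennreal p * indicator A 1 + ennreal (1 - p) * emeasure W A"
proof -
  have "emeasure (spike_slab p W) A =
      ennreal p * emeasure (return unit_borel 1) A + ennreal (1 - p) * emeasure W A"
  proof (rule emeasure_measure_of[OF spike_slab_def])
    show "sets unit_borel \<subseteq> Pow {0..1}"
      using sets.space_closed[of unit_borel] by (simp add: space_restrict_space)
    show "A \<in> sets (spike_slab p W)"
      using A by simp
    show "positive (sets (spike_slab p W))
        (\<lambda>A. ennreal p * emeasure (return unit_borel 1) A + ennreal (1 - p) * emeasure W A)"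
      by (simp add: positive_def)
    show "countably_additive (sets (spike_slab p W))
        (\<lambda>A. ennreal p * emeasure (return unit_borel 1) A + ennreal (1 - p) * emeasure W A)"
    proof (rule countably_additiveI)
      fix F :: "nat \<Rightarrow> real set"
      assume F: "range F \<subseteq> sets (spike_slab p W)" "disjoint_family F"
      have "(\<Sum>i. emeasure (return unit_borel 1) (F i)) = emeasure (return unit_borel 1) (\<Union>i. F i)"
        using F by (intro suminf_emeasure) auto
      moreover have "(\<Sum>i. emeasure W (F i)) = emeasure W (\<Union>i. F i)"
        using F W by (intro suminf_emeasure) auto
      ultimately show "(\<Sum>i. ennreal p * emeasure (return unit_borel 1) (F i)
          + ennreal (1 - p) * emeasure W (F i)) =
        ennreal p * emeasure (return unit_borel 1) (\<Union>i. F i)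
          + ennreal (1 - p) * emeasure W (\<Union>i. F i)"
        by (simp add: suminf_add[symmetric] ennreal_suminf_cmult)
    qed
  qed
  then show ?thesis
    using A by simp
qed

end

theory Submission
  imports Defs "HOL-Real_Asymp.Real_Asymp"
begin

text \<open>
  On \<open>{s. k \<le> n * (1 - s) < k + 1}\<close> we have \<open>s ^ n \<le> exp (- n * (1 - s)) \<le> exp (- k)\<close>, and the
  slab gives this set mass at most a constant times \<open>((k + 1) / n) powr \<gamma>\<close>. Summing over \<open>k\<close>, the
  part of the evidence that comes from \<open>s < 1\<close> is \<open>O(n powr - \<gamma>)\<close>, whereas the spike at 1
  contributes at least \<open>p\<close> for every \<open>n\<close>.
\<close>

text \<open>Exponential decay beats every power. The value of this series becomes the factor of the
  final bound that does not depend on \<open>n\<close>.\<close>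

lemma summable_exp_minus_powr: "summable (\<lambda>k. exp (- real k) * (real k + 1) powr \<gamma>)"
proof (rule summable_comparison_test_bigo)
  show "summable (\<lambda>k. norm (1 / real k ^ 2))"
    using inverse_power_summable[of 2, where ?'a = real] by (simp add: divide_inverse)
  show "(\<lambda>k. exp (- real k) * (real k + 1) powr \<gamma>) \<in> O(\<lambda>k. 1 / real k ^ 2)"
    by real_asymp
qed

text \<open>A single term, the one for the layer containing \<open>s\<close>, already dominates
  \<open>s ^ n\<close>. The sets are nested intervals ending at 1 instead of disjoint layers; this
  only enlarges the sum and matches the shape of the tail hypothesis.\<close>

lemma power_le_exp_layers:
  fixes s :: real
  assumes s: "s \<in> {0..1}" and n: "n > 0"
  shows "s ^ n \<le> (\<Sum>k\<le>n. exp (- real k) * indicator {1 - (real k + 1) / real n..1} s)"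
proof -
  define j where "j = nat \<lfloor>real n * (1 - s)\<rfloor>"
  have nonneg: "0 \<le> real n * (1 - s)"
    using s by simp
  then have j: "real j \<le> real n * (1 - s)" "real n * (1 - s) < real j + 1"
    by (auto simp: j_def)
  \<comment> \<open>The index \<open>j = n\<close> does occur, at \<open>s = 0\<close>, so the sum
    has to include \<open>n\<close>.\<close>
  have "real n * (1 - s) \<le> real n"
    using s by (simp add: mult_left_le)
  with j have jn: "j \<le> n"
    by linarith
  \<comment> \<open>This is \<open>1 + x \<le> exp x\<close> at \<open>x = s - 1\<close>.\<close>
  have "s ^ n \<le> exp (s - 1) ^ n"
    using s exp_ge_add_one_self[of "s - 1"] by (intro power_mono) auto
  also have "\<dots> = exp (- (real n * (1 - s)))"
    by (simp add: exp_of_nat_mult[symmetric] algebra_simps)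
  also have "\<dots> \<le> exp (- real j)"
    using j by simp
  \<comment> \<open>The indicator is 1 because \<open>n * (1 - s) < j + 1\<close>.\<close>
  also have "\<dots> = exp (- real j) * indicator {1 - (real j + 1) / real n..1} s"
    using j s n by (auto simp: indicator_def field_simps)
  also have "\<dots> \<le> (\<Sum>k\<le>n. exp (- real k) * indicator {1 - (real k + 1) / real n..1} s)"
    using jn
    by (intro member_le_sum[of j "{..n}"
          "\<lambda>k. exp (- real k) * indicator {1 - (real k + 1) / real n..1} s"]) auto
  finally show ?thesis .
qed

text \<open>Integrate the layer bound termwise. Restricting to \<open>A\<close> allows the atom at 1
  to be cut out, since a set containing it has no small tails. The tail bound is asked for all
  \<open>u > 0\<close> because \<open>u = (k + 1) / n\<close> goes up to
  \<open>(n + 1) / n\<close>.\<close>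

lemma set_integral_power_le:
  fixes M :: "real measure" and K \<gamma> :: real
  assumes "finite_measure M" and M: "sets M = sets unit_borel" and A: "A \<in> sets M"
    and n: "n > 0"
    and tail: "\<And>u. u > 0 \<Longrightarrow> measure M ({1 - u..1} \<inter> A) \<le> K * u powr \<gamma>"
  shows "(LINT s:A|M. s ^ n) \<le>
    K * (\<Sum>k. exp (- real k) * (real k + 1) powr \<gamma>) * real n powr - \<gamma>"
proof -
  interpret finite_measure M by fact
  define B where "B k = {1 - (real k + 1) / real n..1} \<inter> A" for k :: nat
  have sp: "space M = {0..1}"
    using sets_eq_imp_space_eq[OF M] by (simp add: space_restrict_space)
  have "A \<subseteq> {0..1}"
    using sets.sets_into_space[OF A] sp by simp
  have B: "B k \<in> sets M" for k
  proof -
    \<comment> \<open>For \<open>k = n\<close> the left endpoint is negative, hence the cut with the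
      unit interval.\<close>
    have "B k = ({1 - (real k + 1) / real n..1} \<inter> {0..1}) \<inter> A"
      using \<open>A \<subseteq> {0..1}\<close> by (auto simp: B_def)
    moreover have "{1 - (real k + 1) / real n..1} \<inter> {0..1} \<in> sets M"
      by (subst M) (auto simp: sets_restrict_space)
    ultimately show ?thesis
      using A by auto
  qed
  \<comment> \<open>At \<open>u = 1\<close> the tail bound is \<open>K\<close> itself.\<close>
  have K: "0 \<le> K"
    using order_trans[OF measure_nonneg tail[of 1]] by simp
  have int: "integrable M (\<lambda>s. \<Sum>k\<le>n. exp (- real k) * indicator (B k) s)"
    using B by (intro Bochner_Integration.integrable_sum integrable_mult_right
        integrable_real_indicator) (auto simp: less_top[symmetric])
  have "(LINT s:A|M. s ^ n) \<le> (LINT s|M. (\<Sum>k\<le>n. exp (- real k) * indicator (B k) s))"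
    unfolding set_lebesgue_integral_def
  proof (rule integral_mono'[OF int])
    fix s assume s: "s \<in> space M"
    show "indicat_real A s *\<^sub>R s ^ n \<le> (\<Sum>k\<le>n. exp (- real k) * indicator (B k) s)"
      using power_le_exp_layers[of s n] s sp n
      by (auto simp: indicator_inter_arith B_def indicator_def sum_nonneg)
    show "0 \<le> (\<Sum>k\<le>n. exp (- real k) * indicat_real (B k) s)"
      by (auto intro!: sum_nonneg)
  qed
  also have "\<dots> = (\<Sum>k\<le>n. exp (- real k) * measure M (B k))"
    using B by (subst Bochner_Integration.integral_sum)
      (auto intro!: integrable_mult_right simp: less_top[symmetric])
  also have "\<dots> \<le> (\<Sum>k\<le>n. exp (- real k) * (K * ((real k + 1) / real n) powr \<gamma>))"
    using n by (intro sum_mono mult_left_mono) (auto simp: B_def intro!: tail)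
  also have "\<dots> = K * real n powr - \<gamma> * (\<Sum>k\<le>n. exp (- real k) * (real k + 1) powr \<gamma>)"
    by (simp add: sum_distrib_left powr_divide powr_minus_divide mult_ac)
  also have "\<dots> \<le> K * real n powr - \<gamma> * (\<Sum>k. exp (- real k) * (real k + 1) powr \<gamma>)"
    using K by (intro mult_left_mono sum_le_suminf summable_exp_minus_powr) auto
  finally show ?thesis
    by (simp add: mult_ac)
qed

text \<open>Beyond \<open>\<delta>\<close> a probability is at most
  \<open>1 \<le> (u / \<delta>) powr \<gamma>\<close>, which the extra summand
  \<open>\<delta> powr - \<gamma>\<close> pays for.\<close>

lemma prob_le_powr_extend:
  fixes C \<gamma> \<delta> :: real
  assumes "prob_space M" and "C > 0" and "\<gamma> > 0" and "\<delta> > 0"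
    and tail: "\<And>u. u \<in> {0<..\<delta>} \<Longrightarrow> measure M (B u) \<le> C * u powr \<gamma>"
    and u: "u > 0"
  shows "measure M (B u) \<le> (C + \<delta> powr - \<gamma>) * u powr \<gamma>"
proof (cases "u \<le> \<delta>")
  case True
  then show ?thesis
    using tail[of u] u by (simp add: distrib_right add_increasing2)
next
  case False
  interpret prob_space M by fact
  have "1 \<le> \<delta> powr - \<gamma> * u powr \<gamma>"
    using False assms by (simp add: powr_minus_divide powr_mono2)
  moreover have "0 \<le> C * u powr \<gamma>"
    using \<open>C > 0\<close> by simp
  ultimately show ?thesis
    unfolding distrib_right using prob_le_1[of "B u"] by linarith
qed

theorem proposition5p5:
  fixes p C \<gamma> \<delta> :: real and W :: "real measure"
  assumes "0 < p" and "p \<le> 1"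
    and "prob_space W"
    and "\<exists>f \<in> borel_measurable unit_lborel. W = density unit_lborel f"
    and "C > 0" and "\<gamma> > 0" and "\<delta> > 0"
    and "\<forall>u \<in> {0<..\<delta>}. measure W ({1 - u..1} \<inter> {0..1}) \<le> C * u powr \<gamma>"
  shows "(\<lambda>n. 1 - posterior (spike_slab p W) n {1}) \<in> O(\<lambda>n. real n powr (- \<gamma>))"
proof -
  interpret W: prob_space W by fact
  define P where "P = spike_slab p W"
  have sW: "sets W = sets unit_borel"
  proof -
    have "sets W = sets unit_lborel"
      using assms(4) by auto
    also have "\<dots> = sets unit_borel"
      by (rule sets_restrict_space_cong) simp
    finally show ?thesis .
  qed
  have sP: "sets P = sets unit_borel" and spP: "space P = {0..1}"
    by (simp_all add: P_def)
  have eP: "emeasure P A = ennreal (p * indicator A 1 + (1 - p) * measure W A)"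
    if "A \<in> sets P" for A
    using that assms(1,2) sP
    by (simp add: P_def emeasure_spike_slab[OF sW] W.emeasure_eq_measure ennreal_mult'
        flip: ennreal_indicator)
  have mP: "measure P A = p * indicator A 1 + (1 - p) * measure W A" if "A \<in> sets P" for A
    using that assms(1,2) by (simp add: measure_def[of P] eP del: ennreal_plus)
  have "space P \<in> sets P"
    by simp
  then have finP: "finite_measure P"
    by (intro finite_measureI) (simp add: eP)
  interpret P: finite_measure P by fact
  have one: "{1} \<in> sets P" and below: "{0..<1} \<in> sets P"
    by (auto simp: sP sets_restrict_space_iff)
  define K where "K = C + \<delta> powr - \<gamma>"
  \<comment> \<open>Away from 1 the spike vanishes and \<open>P\<close> is \<open>(1 - p)\<close>
    times \<open>W\<close>, hence at most \<open>W\<close>.\<close>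
  have tail: "measure P ({1 - u..1} \<inter> {0..<1}) \<le> K * u powr \<gamma>" if "u > 0" for u
  proof -
    have "{1 - u..1} \<inter> {0..1} \<in> sets P" "{1 - u..1} \<inter> {0..<1} \<in> sets P"
      by (auto simp: sP sets_restrict_space_iff)
    then have "measure P ({1 - u..1} \<inter> {0..<1}) \<le> measure W ({1 - u..1} \<inter> {0..1})"
      using assms(1,2) sP sW
      by (auto simp: mP intro!: order_trans[OF mult_left_le_one_le] W.finite_measure_mono)
    also have "\<dots> \<le> K * u powr \<gamma>"
      unfolding K_def
      using prob_le_powr_extend[OF assms(3) assms(5-7), of "\<lambda>u. {1 - u..1} \<inter> {0..1}"] assms(8) that
      by auto
    finally show ?thesis .
  qed
  define S where "S = (\<Sum>k. exp (- real k) * (real k + 1) powr \<gamma>)"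
  have bound: "norm (1 - posterior P n {1}) \<le> (K * S / p) * norm (real n powr - \<gamma>)"
    if n: "n > 0" for n
  proof -
    define I where "I = (LINT s:{0..<1}|P. s ^ n)"
    have "(\<lambda>s. s ^ n) \<in> borel_measurable P"
      unfolding measurable_cong_sets[OF sP refl] by (rule measurable_restrict_space1) simp
    then have bdd: "integrable P (\<lambda>s. s ^ n)"
      by (intro P.integrable_const_bound[of _ 1]) (auto simp: spP power_le_one)
    \<comment> \<open>The spike keeps its full mass for every \<open>n\<close>, as
      \<open>1 ^ n = 1\<close>.\<close>
    have Q: "(LINT s:{1}|P. s ^ n) = measure P {1}"
    proof -
      have "(LINT s:{1}|P. s ^ n) = (LINT s|P. indicator {1} s)"
        unfolding set_lebesgue_integral_def
        by (rule Bochner_Integration.integral_cong) (auto simp: indicator_def)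
      then show ?thesis
        using one by simp
    qed
    have "set_integrable P {1} (\<lambda>s. s ^ n)" "set_integrable P {0..<1} (\<lambda>s. s ^ n)"
      unfolding set_integrable_def using bdd one below by (intro integrable_mult_indicator; simp)+
    then have "(LINT s:{1} \<union> {0..<1}|P. s ^ n) = measure P {1} + I"
      by (subst set_integral_Un) (auto simp: Q I_def)
    moreover have "{1} \<union> {0..<1} = space P"
      by (auto simp: spP)
    ultimately have D: "(LINT s|P. s ^ n) = measure P {1} + I"
      using bdd by (simp add: set_integral_space)
    have I0: "0 \<le> I"
      unfolding I_def set_lebesgue_integral_def
      by (rule Bochner_Integration.integral_nonneg) (auto simp: spP)
    have I: "I \<le> K * S * real n powr - \<gamma>"
      unfolding I_def S_def by (rule set_integral_power_le[OF finP sP below n tail])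
    have pm: "p \<le> measure P {1}"
      using one assms(1,2) by (simp add: mP)
    \<comment> \<open>With the evidence split at 1, the posterior mass off the spike is the share of
      \<open>I\<close>; the denominator is then bounded below by \<open>p\<close>.\<close>
    have "1 - posterior P n {1} = I / (measure P {1} + I)"
      using pm I0 assms(1) by (simp add: posterior_eq[OF spP] Q D field_simps)
    moreover have "I / (measure P {1} + I) \<le> I / p"
      using pm I0 assms(1) by (intro divide_left_mono) auto
    moreover have "I / p \<le> K * S * real n powr - \<gamma> / p"
      using I assms(1) by (intro divide_right_mono) auto
    ultimately show ?thesis
      using I0 pm assms(1) by simp
  qed
  show ?thesis
    unfolding P_def[symmetric]
    by (rule bigoI, rule eventually_mono[OF eventually_gt_at_top[of 0]], rule bound)
qed

end
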